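(* Let $(G,+)$ be an abelian group and let $n\le s, s'<m$ be nonnegative integers with $m<\lceil\log_2 p(G)\rceil/2$. Let $a\in G$ be nonzero and let $S\subseteq [m]_a$ be an $n$-subset. Let $M=\mathcal{P}_{n,s,m}(a)$ or $M=SM_m(a,S)$. Then $M$ is matched to $\mathcal{P}_{n,s',m}(a)$ if and only if $s'=m-1$.
   Context: $p(G)$ is the smallest cardinality of a nonzero finite subgroup of $G$, with $p(G)=\infty$ if none exists (so the condition on $m$ is vacuous for torsion-free $G$). Under this condition one fixes a total order $\preceq$ on $[2m]_a\cup\{0\}$ compatible with the group structure (for $x,y,z$ in the set, $x\preceq y$ implies $x+z\preceq y+z$ when these sums lie in the set). For positive integer $k$, $ka=a+\cdots+a$ ($k$ times) and $[k]_a=\{a,2a,\dots,ka\}$. Extended panhandle matroid: for $n\le s<m$, $\mathcal{P}_{n,s,m}(a)$ is the rank-$n$ matroid on ground set $[m]_a$ whose bases are the $n$-subsets $B\subseteq[m]_a$ with $|B\cap[s]_a|\ge n-1$. Extended Schubert matroid: for an $n$-subset $S\subseteq[m]_a$, $SM_m(a,S)$ is the rank-$n$ matroid on $[m]_a$ whose bases are the $n$-subsets $T\subseteq[m]_a$ such that the $i$-th smallest element of $T$ does not exceed the $i$-th smallest element of $S$ for each $1\le i\le n$ (with respect to $\preceq$ when $a$ is positive; for negative $a$ the analogous counterpart, i.e. comparing $ka$ by the index $k$). Matchings: for matroids $M,N$ over $G$ (ground sets in $G$) of equal rank $n>0$, ordered bases $\{a_1,\dots,a_n\}$ of $M$ and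 $\{b_1,\dots,b_n\}$ of $N$ are matched if $a_i+b_i\notin E(M)$ for all $i$; $M$ is matched to $N$ if every basis of $M$ is matched to some basis of $N$.
   Formalization: For n = 1 only "if s'=m-1 then M is matched" is stated: the converse is false there (G = Z, a = 1, n = s = s' = 1, m = 3: every {i} is matched to {3}). The equivalence is stated for n ≥ 2; rank n = 0 is excluded, as matchings require n > 0. *)

theory Defs
  imports Complex_Main "HOL-Library.Extended_Nat"
begin

section \<open>Abelian groups\<close>

definition nmult :: "nat \<Rightarrow> 'g::ab_group_add \<Rightarrow> 'g" where
  "nmult k a = (\<Sum>_\<in>{1..k}. a)"

text \<open>The set \<open>[k]_a = {a, 2a, ..., ka}\<close>.\<close>

definition multiples :: "nat \<Rightarrow> 'g::ab_group_add \<Rightarrow> 'g set" where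
  "multiples k a = (\<lambda>i. nmult i a) ` {1..k}"

definition add_subgroup :: "'g::ab_group_add set \<Rightarrow> bool" where
  "add_subgroup H \<longleftrightarrow> 0 \<in> H \<and> (\<forall>x\<in>H. \<forall>y\<in>H. x + y \<in> H) \<and> (\<forall>x\<in>H. - x \<in> H)"

text \<open>\<open>p(G)\<close>. In \<^typ>\<open>enat\<close> the infimum of the empty set is \<open>\<infinity>\<close>.\<close>

definition min_subgroup_card :: "'g::ab_group_add itself \<Rightarrow> enat" where
  "min_subgroup_card _ =
     Inf {enat (card H) | H :: 'g set. add_subgroup H \<and> finite H \<and> H \<noteq> {0}}"

text \<open>\<open>r\<close> is a total order on \<open>[2m]_a \<union> {0}\<close> compatible with addition; \<open>(x, y) \<in> r\<close> means
  \<open>x \<preceq> y\<close>.\<close>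

definition compatible_order :: "nat \<Rightarrow> 'g::ab_group_add \<Rightarrow> 'g rel \<Rightarrow> bool" where
  "compatible_order m a r \<longleftrightarrow>
     (let X = multiples (2 * m) a \<union> {0} in
       linear_order_on X r \<and>
       (\<forall>x\<in>X. \<forall>y\<in>X. \<forall>z\<in>X. (x, y) \<in> r \<longrightarrow> x + z \<in> X \<longrightarrow> y + z \<in> X \<longrightarrow> (x + z, y + z) \<in> r))"

section \<open>Matroids\<close>

record 'a basis_system =
  ground :: "'a set"
  bases :: "'a set set"

definition matroid :: "'a basis_system \<Rightarrow> bool" where
  "matroid M \<longleftrightarrow> finite (ground M) \<and> bases M \<noteq> {} \<and> (\<forall>B\<in>bases M. B \<subseteq> ground M) \<and>
     (\<forall>B1\<in>bases M. \<forall>B2\<in>bases M. \<forall>x\<in>B1 - B2. \<exists>y\<in>B2 - B1. insert y (B1 - {x}) \<in> bases M)"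

text \<open>\<open>n - 1\<close> is truncated subtraction; for \<open>n = 0\<close> the inequality holds trivially either way.\<close>

definition panhandle :: "nat \<Rightarrow> nat \<Rightarrow> nat \<Rightarrow> 'g::ab_group_add \<Rightarrow> 'g basis_system" where
  "panhandle n s m a =
     \<lparr>ground = multiples m a,
      bases = {B. B \<subseteq> multiples m a \<and> card B = n \<and> card (B \<inter> multiples s a) \<ge> n - 1}\<rparr>"

text \<open>The \<open>i\<close>-th smallest element of \<open>T\<close>, counted from \<open>1\<close>.\<close>

definition ith_smallest :: "'a rel \<Rightarrow> 'a set \<Rightarrow> nat \<Rightarrow> 'a" where
  "ith_smallest r T i = (THE x. x \<in> T \<and> card {y\<in>T. (y, x) \<in> r} = i)"

definition index_order :: "nat \<Rightarrow> 'g::ab_group_add \<Rightarrow> 'g rel" where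
  "index_order m a = {(nmult i a, nmult j a) | i j. 1 \<le> i \<and> i \<le> j \<and> j \<le> m}"

text \<open>Elements of \<open>[m]_a\<close> are compared by \<open>r\<close> if \<open>a\<close> is positive for \<open>r\<close>, and by their index
  (which is the reverse of \<open>r\<close>) if \<open>a\<close> is negative.\<close>

definition schubert_order :: "'g rel \<Rightarrow> nat \<Rightarrow> 'g::ab_group_add \<Rightarrow> 'g rel" where
  "schubert_order r m a = (if (0, a) \<in> r then r else index_order m a)"

definition schubert :: "'g rel \<Rightarrow> nat \<Rightarrow> 'g::ab_group_add \<Rightarrow> 'g set \<Rightarrow> 'g basis_system" where
  "schubert r m a S =
     \<lparr>ground = multiples m a,
      bases = {T. T \<subseteq> multiples m a \<and> card T = card S \<and>
        (\<forall>i\<in>{1..card S}. (ith_smallest (schubert_order r m a) T i,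
                          ith_smallest (schubert_order r m a) S i) \<in> schubert_order r m a)}\<rparr>"

section \<open>Matchings\<close>

definition ordered_basis :: "'a basis_system \<Rightarrow> 'a list \<Rightarrow> bool" where
  "ordered_basis M xs \<longleftrightarrow> distinct xs \<and> set xs \<in> bases M"

definition matched_bases :: "'g::ab_group_add basis_system \<Rightarrow> 'g list \<Rightarrow> 'g list \<Rightarrow> bool" where
  "matched_bases M as bs \<longleftrightarrow>
     length as = length bs \<and> (\<forall>i<length as. as ! i + bs ! i \<notin> ground M)"

definition matched_to :: "'g::ab_group_add basis_system \<Rightarrow> 'g basis_system \<Rightarrow> bool" where
  "matched_to M N \<longleftrightarrow>
     (\<forall>as. ordered_basis M as \<longrightarrow> (\<exists>bs. ordered_basis N bs \<and> matched_bases M as bs))"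

section \<open>The matroid axioms hold\<close>

text \<open>The definitions do not depend on this section. It shows that under the bound on \<open>m\<close> the two
  basis systems above are matroids and that compatible orders exist, with either sign for \<open>a\<close>.\<close>

lemma nmult_0 [simp]: "nmult 0 a = 0" by (simp add: nmult_def)
lemma nmult_Suc [simp]: "nmult (Suc k) a = nmult k a + a" by (simp add: nmult_def)

lemma nmult_add: "nmult (i + j) a = nmult i a + nmult j a"
  by (induction j) (auto simp: algebra_simps)

lemma nmult_mult: "nmult (i * j) a = nmult i (nmult j a)"
  by (induction i) (auto simp: nmult_add algebra_simps)

lemma nmult_zero [simp]: "nmult i 0 = 0"
  by (induction i) auto

lemma nmult_mod: assumes "nmult N a = 0" shows "nmult (i mod N) a = nmult i a"
proof -
  have "nmult i a = nmult (i div N * N + i mod N) a" by simp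
  also have "\<dots> = nmult (i mod N) a" by (simp only: nmult_add nmult_mult assms) simp
  finally show ?thesis by simp
qed

lemma min_subgroup_card_le:
  fixes a :: "'g::ab_group_add"
  assumes "nmult N a = 0" "0 < N" "a \<noteq> 0"
  shows "min_subgroup_card TYPE('g) \<le> enat N"
proof -
  let ?H = "(\<lambda>i. nmult i a) ` {..<N}"
  have all: "nmult i a \<in> ?H" for i
    using nmult_mod[OF assms(1), of i] assms(2) by (metis imageI lessThan_iff mod_less_divisor)
  have sub: "add_subgroup ?H"
    unfolding add_subgroup_def
  proof (intro conjI ballI)
    show "0 \<in> ?H" using all[of 0] by simp
    fix x y assume "x \<in> ?H" "y \<in> ?H"
    then obtain i j where "x = nmult i a" "y = nmult j a" by auto
    then show "x + y \<in> ?H" using all[of "i + j"] by (simp add: nmult_add)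
  next
    fix x assume "x \<in> ?H"
    then obtain i where i: "i < N" "x = nmult i a" by auto
    have "nmult (N - i) a + nmult i a = 0" using assms(1) i by (metis nmult_add le_add_diff_inverse2 less_imp_le)
    then show "- x \<in> ?H" using all i by (metis add_eq_0_iff2)
  qed
  have "?H \<noteq> {0}" using all[of 1] assms(3) by auto
  then have "min_subgroup_card TYPE('g) \<le> enat (card ?H)"
    unfolding min_subgroup_card_def using sub by (intro Inf_lower) blast
  also have "\<dots> \<le> enat N" using card_image_le[of "{..<N}" "\<lambda>i. nmult i a"] by simp
  finally show ?thesis .
qed

lemma four_le: "4 * m \<le> (4::nat)^m"
proof (induction m)
  case (Suc m) then show ?case by (cases m) auto
qed simp

lemma inj_on_nmult:
  fixes a :: "'g::ab_group_add"
  assumes "\<forall>q. min_subgroup_card TYPE('g) = enat q \<longrightarrow> real m < real_of_int \<lceil>log 2 (real q)\<rceil> / 2" "a \<noteq> 0"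
  shows "inj_on (\<lambda>i. nmult i a) {..4 * m}"
proof -
  have key: False if "i < j" "j \<le> 4 * m" "nmult i a = nmult j a" for i j
  proof -
    have "nmult (j - i) a + nmult i a = nmult j a" using that by (metis nmult_add le_add_diff_inverse2 less_imp_le)
    then have z: "nmult (j - i) a = 0" using that by simp
    have le: "min_subgroup_card TYPE('g) \<le> enat (j - i)" using min_subgroup_card_le[OF z] that assms by simp
    then obtain q where q: "min_subgroup_card TYPE('g) = enat q" by (metis enat_ile)
    then have "q \<le> 4 * m" using le that by simp
    have "2 * real m < real_of_int \<lceil>log 2 (real q)\<rceil>" using assms(1) q by fastforce
    then have "real_of_int (2 * int m) < real_of_int \<lceil>log 2 (real q)\<rceil>" by simp
    then have "2 * int m < \<lceil>log 2 (real q)\<rceil>" by (simp only: of_int_less_iff)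
    then have lg: "2 * real m < log 2 (real q)" by (simp add: less_ceiling_iff)
    have "q > 0" using lg by (cases "q = 0") (auto simp: log_def)
    then have "2 powr (2 * real m) < real q" using lg by (subst (asm) less_log_iff) auto
    then have "real (4 ^ m) < real q" by (simp add: powr_powr[symmetric] powr_realpow)
    then have "4 ^ m < q" by linarith
    then show False using four_le[of m] \<open>q \<le> 4 * m\<close> by simp
  qed
  show ?thesis by (rule inj_onI) (metis atMost_iff key nat_neq_iff)
qed

lemma compatible_order_exists:
  fixes a :: "'g::ab_group_add"
  assumes "inj_on (\<lambda>i. nmult i a) {..4 * m}"
  shows "compatible_order m a {(nmult i a, nmult j a) | i j. i \<le> j \<and> j \<le> 2 * m}"
    and "compatible_order m a {(nmult j a, nmult i a) | i j. i \<le> j \<and> j \<le> 2 * m}"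
proof -
  let ?f = "\<lambda>i. nmult i a"
  let ?r = "{(nmult i a, nmult j a) | i j. i \<le> j \<and> j \<le> 2 * m}"
  let ?r' = "{(nmult j a, nmult i a) | i j. i \<le> j \<and> j \<le> 2 * m}"
  have inj: "nmult i a = nmult j a \<longleftrightarrow> i = j" if "i \<le> 4 * m" "j \<le> 4 * m" for i j
    using assms that unfolding inj_on_def by auto
  have X: "multiples (2 * m) a \<union> {0} = ?f ` {..2 * m}"
  proof -
    have "{..2*m} = insert 0 {1..2*m}" by auto
    then show ?thesis by (simp add: multiples_def)
  qed
  have rel: "(?f i, ?f j) \<in> ?r \<longleftrightarrow> i \<le> j" if "i \<le> 2*m" "j \<le> 2*m" for i j
    using that inj by (auto; metis inj le_trans mult_le_mono1 numeral_le_iff semiring_norm(69) semiring_norm(68) semiring_norm(71) semiring_norm(75))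
  have conv: "?r' = ?r\<inverse>" by auto
  have lin: "linear_order_on (?f ` {..2*m}) ?r"
    unfolding linear_order_on_def partial_order_on_def preorder_on_def
  proof (intro conjI)
    show "refl_on (?f ` {..2*m}) ?r" by (auto simp: refl_on_def)
    show "?r \<subseteq> ?f ` {..2*m} \<times> ?f ` {..2*m}" by auto
    show "total_on (?f ` {..2*m}) ?r" using rel by (auto simp: total_on_def)
    show "trans ?r"
    proof (rule transI)
      fix x y z assume "(x,y) \<in> ?r" "(y,z) \<in> ?r"
      then obtain i j k l where h: "x = ?f i" "y = ?f j" "i \<le> j" "j \<le> 2*m" "y = ?f k" "z = ?f l" "k \<le> l" "l \<le> 2*m" by blast
      then have "j = k" using inj[of j k] by simp
      then have "i \<le> l" using h by linarith
      then show "(x,z) \<in> ?r" using h by blast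
    qed
    show "antisym ?r"
    proof (rule antisymI)
      fix x y assume "(x,y) \<in> ?r" "(y,x) \<in> ?r"
      then obtain i j k l where h: "x = ?f i" "y = ?f j" "i \<le> j" "j \<le> 2*m" "y = ?f k" "x = ?f l" "k \<le> l" "l \<le> 2*m" by blast
      then have "j = k" "i = l" using inj[of j k] inj[of i l] by simp_all
      then show "x = y" using h by auto
    qed
  qed
  have add: "(x + z, y + z) \<in> ?r"
    if h: "(x,y) \<in> ?r" "z \<in> ?f ` {..2*m}" "x + z \<in> ?f ` {..2*m}" "y + z \<in> ?f ` {..2*m}" for x y z
  proof -
    obtain i j k where e: "x = ?f i" "y = ?f j" "i \<le> j" "j \<le> 2*m" "z = ?f k" "k \<le> 2*m" using h by blast
    obtain u where "?f (j + k) = ?f u" "u \<le> 2*m" using h(4) e by (auto simp: nmult_add)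
    then have "j + k \<le> 2*m" using inj[of "j+k" u] e by simp
    moreover have "x + z = ?f (i + k)" "y + z = ?f (j + k)" using e by (simp_all add: nmult_add)
    moreover have "i + k \<le> j + k" using e by simp
    ultimately show ?thesis by blast
  qed
  show "compatible_order m a ?r"
    unfolding compatible_order_def Let_def X using lin add by blast
  show "compatible_order m a ?r'"
    unfolding compatible_order_def Let_def X conv
    using lin add by (auto simp: linear_order_on_converse simp del: mem_Collect_eq) 
qed

lemma matroid_panhandle:
  assumes "inj_on (\<lambda>i. nmult i a) {1..m}" "n \<le> s" "s \<le> m"
  shows "matroid (panhandle n s m a)"
proof -
  let ?E = "multiples m a" let ?A = "multiples s a"
  have fin: "finite ?E" by (simp add: multiples_def)
  have cA: "card ?A = s"
  proof -
    from assms(1) have "inj_on (\<lambda>i. nmult i a) {1..s}" by (rule inj_on_subset) (use assms in auto)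
    then show ?thesis by (simp add: multiples_def card_image)
  qed
  have sub: "?A \<subseteq> ?E" using assms(3) by (auto simp: multiples_def)
  obtain B where B: "B \<subseteq> ?A" "card B = n" using assms(2) cA by (metis obtain_subset_with_card_n)
  then have "B \<in> bases (panhandle n s m a)" using sub by (auto simp: panhandle_def Int_absorb2)
  then have ne: "bases (panhandle n s m a) \<noteq> {}" by auto
  have "\<exists>y\<in>B2 - B1. insert y (B1 - {x}) \<in> bases (panhandle n s m a)"
    if B12: "B1 \<in> bases (panhandle n s m a)" "B2 \<in> bases (panhandle n s m a)" "x \<in> B1 - B2" for B1 B2 x
  proof -
    have b1: "B1 \<subseteq> ?E" "card B1 = n" "n - 1 \<le> card (B1 \<inter> ?A)"
      and b2: "B2 \<subseteq> ?E" "card B2 = n" "n - 1 \<le> card (B2 \<inter> ?A)"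
      using B12 by (auto simp: panhandle_def)
    have f: "finite B1" "finite B2" using b1 b2 fin finite_subset by blast+
    have *: ?thesis if "y \<in> B2 - B1" "n - 1 \<le> card (insert y (B1 - {x}) \<inter> ?A)" for y
    proof (rule bexI[OF _ that(1)])
      have "card (insert y (B1 - {x})) = n"
        using f \<open>x \<in> B1 - B2\<close> that b1 by (metis DiffD1 DiffD2 card.insert card.remove finite_Diff insert_Diff insertCI insertE)
      then show "insert y (B1 - {x}) \<in> bases (panhandle n s m a)"
        using b1 b2 that by (auto simp: panhandle_def)
    qed
    show ?thesis
    proof (cases "B1 - {x} \<subseteq> ?A")
      case True
      obtain y where y: "y \<in> B2 - B1"
        using b1 b2 f B12(3) by (metis DiffD1 DiffD2 card_subset_eq subsetI DiffI)
      have "card (B1 - {x}) \<le> card (insert y (B1 - {x}) \<inter> ?A)"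
        by (rule card_mono) (use True f in auto)
      then show ?thesis using *[OF y] b1 B12(3) f by simp
    next
      case False
      then obtain e where e: "e \<in> B1" "e \<noteq> x" "e \<notin> ?A" by auto
      have xA: "x \<in> ?A"
      proof (rule ccontr)
        assume "x \<notin> ?A"
        then have "B1 \<inter> ?A \<subseteq> B1 - {x, e}" using e by auto
        then have "card (B1 \<inter> ?A) \<le> card (B1 - {x,e})" using f by (intro card_mono) auto
        also have "\<dots> = n - 2" using e B12 f b1 by (subst card_Diff_subset) auto
        moreover have "n \<ge> 2" using e B12 f b1 card_mono[of B1 "{x,e}"] by simp
        ultimately show False using b1 by linarith
      qed
      have lt: "card (B1 \<inter> ?A) < n" using e f b1 by (metis IntD2 Int_lower1 psubsetI psubset_card_mono)
      have "\<exists>y\<in>B2 - B1. y \<in> ?A"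
      proof (rule ccontr)
        assume "\<not> ?thesis"
        then have "B2 \<inter> ?A \<subset> B1 \<inter> ?A" using xA B12 by auto
        then show False using psubset_card_mono[of "B1 \<inter> ?A" "B2 \<inter> ?A"] f lt b2 by auto
      qed
      then obtain y where y: "y \<in> B2 - B1" "y \<in> ?A" by auto
      have "insert y (B1 - {x}) \<inter> ?A = insert y (B1 \<inter> ?A - {x})" using y by auto
      moreover have "card \<dots> = card (B1 \<inter> ?A)"
        using y xA B12 f by (metis DiffD1 DiffD2 Int_iff card.insert card.remove finite_Diff finite_Int insertE insert_Diff insertCI)
      ultimately show ?thesis using *[OF y(1)] b1 by simp
    qed
  qed
  then show ?thesis using ne fin unfolding matroid_def by (auto simp: panhandle_def)
qed

lemma mem_schubert_order_iff:
  fixes a :: "'g::ab_group_add"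
  assumes "inj_on (\<lambda>i. nmult i a) {..4 * m}" "compatible_order m a r" "1 \<le> i" "i \<le> m" "1 \<le> j" "j \<le> m"
  shows "(nmult i a, nmult j a) \<in> schubert_order r m a \<longleftrightarrow> i \<le> j"
proof -
  have inj: "nmult i a = nmult j a \<longleftrightarrow> i = j" if "i \<le> 4 * m" "j \<le> 4 * m" for i j
    using assms(1) that unfolding inj_on_def by auto
  let ?X = "multiples (2 * m) a \<union> {0}"
  have inX: "nmult k a \<in> ?X" if "k \<le> 2 * m" for k
    using that by (cases k) (auto simp: multiples_def simp del: nmult_Suc)
  have lin: "linear_order_on ?X r" and add: "\<And>x y z. x \<in> ?X \<Longrightarrow> y \<in> ?X \<Longrightarrow> z \<in> ?X \<Longrightarrow> (x, y) \<in> r \<Longrightarrow> x + z \<in> ?X \<Longrightarrow> y + z \<in> ?X \<Longrightarrow> (x + z, y + z) \<in> r"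
    using assms(2) unfolding compatible_order_def Let_def by blast+
  show ?thesis
  proof (cases "(0, a) \<in> r")
    case True
    have step: "(nmult k a, nmult (Suc k) a) \<in> r" if "k < m" for k
      using add[of 0 a "nmult k a"] True inX[of k] inX[of "Suc k"] inX[of 1] that by (simp add: add.commute)
    have tr: "trans r" and asym: "antisym r" and rf: "refl_on ?X r" using lin unfolding linear_order_on_def partial_order_on_def preorder_on_def by auto
    have up: "(nmult k a, nmult (k + d) a) \<in> r" if "k + d \<le> m" for k d
      using that
    proof (induction d)
      case 0 then show ?case using rf inX[of k] by (auto simp: refl_on_def)
    next
      case (Suc d) then show ?case using step[of "k + d"] tr by (simp del: nmult_Suc) (meson transD)
    qed
    have "(nmult i a, nmult j a) \<in> r \<longleftrightarrow> i \<le> j" 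
    proof
      assume l: "(nmult i a, nmult j a) \<in> r"
      show "i \<le> j"
      proof (rule ccontr)
        assume n: "\<not> i \<le> j"
        then have "(nmult j a, nmult i a) \<in> r" using up[of j "i - j"] assms by simp
        then show False using l asym inj[of i j] n assms by (auto dest: antisymD)
      qed
    next
      assume "i \<le> j" then show "(nmult i a, nmult j a) \<in> r" using up[of i "j - i"] assms by simp
    qed
    then show ?thesis using True by (simp add: schubert_order_def)
  next
    case False
    have "(nmult i a, nmult j a) \<in> index_order m a \<longleftrightarrow> i \<le> j"
    proof
      assume "(nmult i a, nmult j a) \<in> index_order m a"
      then obtain u v where "nmult i a = nmult u a" "nmult j a = nmult v a" "u \<le> v" "v \<le> m" unfolding index_order_def by blast
      then show "i \<le> j" using inj[of i u] inj[of j v] assms by simp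
    qed (use assms in \<open>auto simp: index_order_def\<close>)
    then show ?thesis using False by (simp add: schubert_order_def)
  qed
qed

lemma ex1_rank:
  assumes "finite (K::nat set)" "1 \<le> i" "i \<le> card K"
  shows "\<exists>!k. k \<in> K \<and> card {j\<in>K. j \<le> k} = i"
proof -
  have "\<exists>k\<in>K. card {j\<in>K. j \<le> k} = i" using assms
  proof (induction c \<equiv> "card K" arbitrary: K)
    case 0
    then show ?case by linarith
  next
    case (Suc c)
    have "K \<noteq> {}" using Suc.hyps(2) by auto
    then have M: "Max K \<in> K" "\<And>j. j \<in> K \<Longrightarrow> j \<le> Max K" using Suc.prems(1) by auto
    show ?case
    proof (cases "i = card K")
      case True
      have "{j\<in>K. j \<le> Max K} = K" using M by blast
      then have "card {j\<in>K. j \<le> Max K} = i" using True by simp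
      with M(1) show ?thesis by (rule bexI[rotated])
    next
      case False
      let ?K = "K - {Max K}"
      have c: "c = card ?K" using Suc.hyps(2) Suc.prems(1) M(1) by (simp add: card_Diff_singleton)
      have "i \<le> card ?K" using False Suc.prems(3) Suc.hyps(2) c by linarith
      then have "\<exists>k\<in>?K. card {j\<in>?K. j \<le> k} = i"
        using Suc.hyps(1)[OF c] Suc.prems(1,2) by blast
      then obtain k where k: "k \<in> ?K" "card {j\<in>?K. j \<le> k} = i" by (rule bexE)
      then have "k < Max K" using M(2)[of k] by force
      then have "{j\<in>?K. j \<le> k} = {j\<in>K. j \<le> k}" by auto
      then have "card {j\<in>K. j \<le> k} = i" using k(2) by simp
      moreover have "k \<in> K" using k(1) by simp
      ultimately show ?thesis by (rule bexI)
    qed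
  qed
  moreover have "k = l" if "k \<in> K" "l \<in> K" "card {j\<in>K. j \<le> k} = i" "card {j\<in>K. j \<le> l} = i" for k l
  proof -
    have *: False if "u < v" "v \<in> K" "card {j\<in>K. j \<le> u} = card {j\<in>K. j \<le> v}" for u v
    proof -
      have "{j\<in>K. j \<le> u} \<subset> {j\<in>K. j \<le> v}" using that(1,2) by force
      then have "card {j\<in>K. j \<le> u} < card {j\<in>K. j \<le> v}"
        by (rule psubset_card_mono[rotated]) (use assms(1) in simp)
      then show False using that(3) by simp
    qed
    show ?thesis using *[of k l] *[of l k] that by (cases k l rule: linorder_cases) auto
  qed
  ultimately show ?thesis by blast
qed

lemma ith_smallest_nmult:
  fixes a :: "'g::ab_group_add"
  assumes "inj_on (\<lambda>i. nmult i a) {..4 * m}" "compatible_order m a r" "K \<subseteq> {1..m}" "k \<in> K" "card {j\<in>K. j \<le> k} = i"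
  shows "ith_smallest (schubert_order r m a) ((\<lambda>i. nmult i a) ` K) i = nmult k a"
proof -
  let ?f = "\<lambda>i. nmult i a"
  have finK: "finite K" using assms(3) finite_subset by blast
  have injK: "inj_on ?f K" using assms(1) by (rule inj_on_subset) (use assms(3) in force)
  have c: "card {y \<in> ?f ` K. (y, ?f l) \<in> schubert_order r m a} = card {j\<in>K. j \<le> l}" if "l \<in> K" for l
  proof -
    have "{y \<in> ?f ` K. (y, ?f l) \<in> schubert_order r m a} = ?f ` {j\<in>K. j \<le> l}"
    proof -
      have "(?f j, ?f l) \<in> schubert_order r m a \<longleftrightarrow> j \<le> l" if "j \<in> K" for j
        using that \<open>l \<in> K\<close> assms(3) by (intro mem_schubert_order_iff[OF assms(1,2)]) force+
      then show ?thesis by blast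
    qed
    moreover have "inj_on ?f {j\<in>K. j \<le> l}" using injK by (rule inj_on_subset) blast
    ultimately show ?thesis by (simp only: card_image)
  qed
  have "card {k} \<le> card {j\<in>K. j \<le> k}" by (rule card_mono) (use assms(4) finK in auto)
  then have "1 \<le> i" using assms(5) by simp
  moreover have "card {j\<in>K. j \<le> k} \<le> card K" by (rule card_mono) (use finK in auto)
  then have "i \<le> card K" using assms(5) by simp
  ultimately have u: "\<exists>!k. k \<in> K \<and> card {j\<in>K. j \<le> k} = i" using ex1_rank finK by blast
  show ?thesis unfolding ith_smallest_def
  proof (rule the_equality)
    show "?f k \<in> ?f ` K \<and> card {y \<in> ?f ` K. (y, ?f k) \<in> schubert_order r m a} = i"
      using c[OF assms(4)] assms(4,5) by simp
    fix x assume x: "x \<in> ?f ` K \<and> card {y \<in> ?f ` K. (y, x) \<in> schubert_order r m a} = i"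
    then obtain l where l: "l \<in> K" "x = ?f l" by blast
    then have "card {j\<in>K. j \<le> l} = i" using c[OF l(1)] x by simp
    then have "l = k" using u l(1) assms(4,5) by blast
    then show "x = ?f k" using l(2) by simp
  qed
qed

lemma rank_le_iff:
  assumes "finite (K::nat set)" "finite L" "card K = card L"
    and k: "\<And>i. i \<in> {1..card L} \<Longrightarrow> k i \<in> K \<and> card {j\<in>K. j \<le> k i} = i"
    and l: "\<And>i. i \<in> {1..card L} \<Longrightarrow> l i \<in> L \<and> card {j\<in>L. j \<le> l i} = i"
  shows "(\<forall>i\<in>{1..card L}. k i \<le> l i) \<longleftrightarrow> (\<forall>z. card {j\<in>L. j \<le> z} \<le> card {j\<in>K. j \<le> z})"
proof
  assume le: "\<forall>i\<in>{1..card L}. k i \<le> l i"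
  show "\<forall>z. card {j\<in>L. j \<le> z} \<le> card {j\<in>K. j \<le> z}"
  proof
    fix z
    let ?i = "card {j\<in>L. j \<le> z}"
    show "?i \<le> card {j\<in>K. j \<le> z}"
    proof (cases "?i = 0")
      case False
      have "?i \<le> card L" by (rule card_mono) (use assms(2) in auto)
      with False have i: "?i \<in> {1..card L}" by (intro iffD2[OF atLeastAtMost_iff] conjI) linarith+
      have "l ?i \<le> z"
      proof (rule ccontr)
        assume "\<not> l ?i \<le> z"
        then have "{j\<in>L. j \<le> z} \<subset> {j\<in>L. j \<le> l ?i}" using l[OF i] by force
        then have "?i < card {j\<in>L. j \<le> l ?i}" by (intro psubset_card_mono) (use assms(2) in auto)
        then show False using l[OF i] by simp
      qed
      then have "k ?i \<le> z" using le i by fastforce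
      then have "card {j\<in>K. j \<le> k ?i} \<le> card {j\<in>K. j \<le> z}" by (intro card_mono) (use assms(1) in auto)
      then show ?thesis using k[OF i] by simp
    next
      case True
      then show ?thesis by linarith
    qed
  qed
next
  assume le: "\<forall>z. card {j\<in>L. j \<le> z} \<le> card {j\<in>K. j \<le> z}"
  show "\<forall>i\<in>{1..card L}. k i \<le> l i"
  proof (rule ballI, rule ccontr)
    fix i assume i: "i \<in> {1..card L}" and "\<not> k i \<le> l i"
    then have "{j\<in>K. j \<le> l i} \<subset> {j\<in>K. j \<le> k i}" using k[OF i] by force
    then have "card {j\<in>K. j \<le> l i} < card {j\<in>K. j \<le> k i}" by (intro psubset_card_mono) (use assms(1) in auto)
    then show False using k[OF i] l[OF i] le[rule_format, of "l i"] by simp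
  qed
qed

lemma schubert_basis_iff:
  fixes a :: "'g::ab_group_add"
  assumes o: "inj_on (\<lambda>i. nmult i a) {..4 * m}" "compatible_order m a r"
    and K: "K \<subseteq> {1..m}" and L: "L \<subseteq> {1..m}"
  shows "(\<lambda>i. nmult i a) ` K \<in> bases (schubert r m a ((\<lambda>i. nmult i a) ` L)) \<longleftrightarrow>
    card K = card L \<and> (\<forall>z. card {j\<in>L. j \<le> z} \<le> card {j\<in>K. j \<le> z})"
proof -
  let ?f = "\<lambda>i. nmult i a" and ?R = "schubert_order r m a"
  have fin: "finite K" "finite L" using K L finite_subset by blast+
  have injm: "inj_on ?f {1..m}" using o(1) by (rule inj_on_subset) auto
  have c: "card (?f ` K) = card K" "card (?f ` L) = card L"
    using card_image[OF inj_on_subset[OF injm K]] card_image[OF inj_on_subset[OF injm L]] by auto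
  have "(\<forall>i\<in>{1..card L}. (ith_smallest ?R (?f ` K) i, ith_smallest ?R (?f ` L) i) \<in> ?R) \<longleftrightarrow>
      (\<forall>z. card {j\<in>L. j \<le> z} \<le> card {j\<in>K. j \<le> z})" if eq: "card K = card L"
  proof -
    have "\<forall>i. \<exists>k. i \<in> {1..card L} \<longrightarrow> k \<in> K \<and> card {j\<in>K. j \<le> k} = i"
      using ex1_rank[OF fin(1)] eq by (metis atLeastAtMost_iff)
    then obtain k where k: "\<And>i. i \<in> {1..card L} \<Longrightarrow> k i \<in> K \<and> card {j\<in>K. j \<le> k i} = i" by metis
    have "\<forall>i. \<exists>k. i \<in> {1..card L} \<longrightarrow> k \<in> L \<and> card {j\<in>L. j \<le> k} = i"
      using ex1_rank[OF fin(2)] by (metis atLeastAtMost_iff)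
    then obtain l where l: "\<And>i. i \<in> {1..card L} \<Longrightarrow> l i \<in> L \<and> card {j\<in>L. j \<le> l i} = i" by metis
    have "(ith_smallest ?R (?f ` K) i, ith_smallest ?R (?f ` L) i) \<in> ?R \<longleftrightarrow> k i \<le> l i"
      if i: "i \<in> {1..card L}" for i
    proof -
      have "ith_smallest ?R (?f ` K) i = ?f (k i)" "ith_smallest ?R (?f ` L) i = ?f (l i)"
        using ith_smallest_nmult[OF o K] ith_smallest_nmult[OF o L] k[OF i] l[OF i] by blast+
      moreover have "k i \<in> {1..m}" "l i \<in> {1..m}" using k[OF i] l[OF i] K L by blast+
      ultimately show ?thesis using mem_schubert_order_iff[OF o, of "k i" "l i"] by simp
    qed
    then show ?thesis using rank_le_iff[OF fin eq k l] by simp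
  qed
  moreover have "?f ` K \<subseteq> multiples m a" using K by (auto simp: multiples_def)
  ultimately show ?thesis by (auto simp: schubert_def c)
qed

lemma matroid_schubert:
  fixes a :: "'g::ab_group_add"
  assumes o: "inj_on (\<lambda>i. nmult i a) {..4 * m}" "compatible_order m a r" and S: "S \<subseteq> multiples m a"
  shows "matroid (schubert r m a S)"
proof -
  let ?f = "\<lambda>i. nmult i a" and ?M = "schubert r m a S"
  obtain L where L: "L \<subseteq> {1..m}" "S = ?f ` L" using S unfolding multiples_def by (meson subset_imageE)
  note basis = schubert_basis_iff[OF o _ L(1), folded L(2)]
  have injm: "inj_on ?f {1..m}" using o(1) by (rule inj_on_subset) auto
  have "S \<in> bases ?M" using basis[OF L(1)] L by simp
  then have ne: "bases ?M \<noteq> {}" by auto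
  have "\<exists>y\<in>B2 - B1. insert y (B1 - {x}) \<in> bases ?M"
    if B: "B1 \<in> bases ?M" "B2 \<in> bases ?M" "x \<in> B1 - B2" for B1 B2 x
  proof -
    have "B1 \<subseteq> ?f ` {1..m}" "B2 \<subseteq> ?f ` {1..m}" using B by (auto simp: schubert_def multiples_def)
    then obtain K1 K2 where K: "K1 \<subseteq> {1..m}" "B1 = ?f ` K1" "K2 \<subseteq> {1..m}" "B2 = ?f ` K2"
      by (meson subset_imageE)
    obtain k where k: "x = ?f k" "k \<in> K1" using B K by auto
    have k2: "k \<notin> K2" using k K B by auto
    have fin: "finite K1" "finite K2" using K finite_subset by blast+
    have b1: "card K1 = card L" "\<And>z. card {j\<in>L. j \<le> z} \<le> card {j\<in>K1. j \<le> z}"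
      using basis[OF K(1)] B K by auto
    have b2: "card K2 = card L" "\<And>z. card {j\<in>L. j \<le> z} \<le> card {j\<in>K2. j \<le> z}"
      using basis[OF K(3)] B K by auto
    have "K2 - K1 \<noteq> {}"
    proof
      assume "K2 - K1 = {}"
      then have "K2 = K1" using b1 b2 fin by (intro card_subset_eq) auto
      then show False using k k2 by simp
    qed
    then have "Min (K2 - K1) \<in> K2 - K1" "\<And>z. z \<in> K2 - K1 \<Longrightarrow> Min (K2 - K1) \<le> z"
      using fin by (auto intro: Min_in Min_le simp del: Diff_iff)
    then obtain y where y: "y \<in> K2 - K1" "\<And>z. z \<in> K2 - K1 \<Longrightarrow> y \<le> z" by blast
    let ?K = "insert y (K1 - {k})"
    have Km: "?K \<subseteq> {1..m}" using K y by auto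
    have "card ?K = Suc (card (K1 - {k}))" using y(1) fin by (subst card_insert_disjoint) auto
    also have "\<dots> = card K1" using k(2) fin(1) by (rule card.remove[symmetric, rotated])
    finally have "card ?K = card L" using b1(1) by simp
    moreover have "card {j\<in>L. j \<le> z} \<le> card {j\<in>?K. j \<le> z}" for z
    proof (cases "y \<le> z \<or> \<not> k \<le> z")
      case True
      have "card {j\<in>K1. j \<le> z} \<le> card {j\<in>?K. j \<le> z}"
      proof (cases "k \<le> z")
        case True
        with \<open>y \<le> z \<or> \<not> k \<le> z\<close> have yz: "y \<le> z" by simp
        have e: "{j\<in>?K. j \<le> z} = insert y ({j\<in>K1. j \<le> z} - {k})" using yz by auto
        have "card {j\<in>K1. j \<le> z} = Suc (card ({j\<in>K1. j \<le> z} - {k}))"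
          using True k fin by (intro card.remove) auto
        also have "\<dots> = card (insert y ({j\<in>K1. j \<le> z} - {k}))" using y fin by (subst card_insert_disjoint) auto
        finally show ?thesis using e by simp
      next
        case False
        then show ?thesis by (intro card_mono) (use fin in auto)
      qed
      then show ?thesis using b1(2)[of z] by linarith
    next
      case False
      then have "{j\<in>K2. j \<le> z} \<subseteq> {j\<in>?K. j \<le> z}" proof (intro subsetI)
        fix j assume j: "j \<in> {j\<in>K2. j \<le> z}"
        then have "j \<notin> K2 - K1" using y(2)[of j] False by force
        then show "j \<in> {j\<in>?K. j \<le> z}" using j k2 by blast
      qed
      then have "card {j\<in>K2. j \<le> z} \<le> card {j\<in>?K. j \<le> z}" by (intro card_mono) (use fin in auto)
      then show ?thesis using b2(2)[of z] by linarith
    qed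
    ultimately have "?f ` ?K \<in> bases ?M" using basis[OF Km] by simp
    moreover have "?f ` (K1 - {k}) = B1 - {x}"
    proof -
      have "k \<in> {1..m}" using K(1) k(2) by blast
      then have "{k} \<subseteq> {1..m}" by simp
      moreover have "K1 - {k} \<subseteq> {1..m}" using K(1) by blast
      ultimately have "?f ` (K1 - {k}) = ?f ` K1 - ?f ` {k}"
        by (intro inj_on_image_set_diff[OF injm])
      then show ?thesis by (simp add: K(2) k(1))
    qed
    moreover have "?f y \<in> B2 - B1"
    proof -
      have "y \<in> {1..m}" "y \<in> K2" "y \<notin> K1" using y(1) K(3) by blast+
      then show ?thesis using inj_on_image_mem_iff[OF injm _ K(1), of y] K(2,4) by blast
    qed
    ultimately show ?thesis by (metis image_insert)
  qed
  moreover have "finite (ground ?M)" "\<forall>B\<in>bases ?M. B \<subseteq> ground ?M"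
    by (auto simp: schubert_def multiples_def)
  ultimately show ?thesis using ne unfolding matroid_def by blast
qed

end

theory Submission
  imports Defs
begin

text \<open>By the bound on \<open>m\<close>, for \<open>i, j \<in> {1..m}\<close> the sum \<open>ia + ja\<close> avoids \<open>[m]_a\<close> iff \<open>i + j > m\<close>.
  If \<open>s' = m - 1\<close>, every \<open>n\<close>-subset is a basis of the panhandle matroid, and \<open>ka \<mapsto> (m + 1 - k)a\<close> is
  a matching. Conversely \<open>{a, ..., na}\<close> is a basis of \<open>M\<close>; in any matching the partner of \<open>a\<close> is
  \<open>ma\<close> and that of \<open>2a\<close> is \<open>(m - 1)a\<close>, so if \<open>s' < m - 1\<close> two elements of the partner basis lie
  outside \<open>[s']_a\<close>.\<close>

text \<open>Since i + j is at most 2m, it stays in the range where the multiples of a are pairwise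
  distinct, so no wrap-around can bring (i + j)a back into [m]_a.\<close>

lemma nmult_add_mem_multiples_iff:
  fixes a :: "'g::ab_group_add"
  assumes inj: "inj_on (\<lambda>i. nmult i a) {..4 * m}" and ij: "i \<in> {1..m}" "j \<in> {1..m}"
  shows "nmult i a + nmult j a \<in> multiples m a \<longleftrightarrow> i + j \<le> m"
proof
  assume "nmult i a + nmult j a \<in> multiples m a"
  then obtain k where k: "k \<in> {1..m}" "nmult (i + j) a = nmult k a"
    by (auto simp: multiples_def nmult_add)
  then have "i + j = k" using inj_onD[OF inj k(2)] ij by auto
  then show "i + j \<le> m" using k by simp
next
  assume "i + j \<le> m"
  then show "nmult i a + nmult j a \<in> multiples m a"
    unfolding multiples_def nmult_add[symmetric] using ij by (intro imageI) auto
qed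

lemma matched_to_panhandle_top:
  fixes a :: "'g::ab_group_add"
  assumes inj: "inj_on (\<lambda>i. nmult i a) {..4 * m}" and ground: "ground M = multiples m a"
    and bases: "\<And>B. B \<in> bases M \<Longrightarrow> B \<subseteq> multiples m a \<and> card B = n"
  shows "matched_to M (panhandle n (m - 1) m a)"
  unfolding matched_to_def
proof (intro allI impI)
  let ?f = "\<lambda>i. nmult i a"
  fix as assume as: "ordered_basis M as"
  then have d: "distinct as" and sub: "set as \<subseteq> ?f ` {1..m}" and len: "length as = n"
    using bases distinct_card[of as] by (auto simp: ordered_basis_def multiples_def)
  have "\<exists>ks. as = map ?f ks \<and> set ks \<subseteq> {1..m}"
    using sub by (induction as) (force intro: exI[of _ "_ # _"])+
  then obtain ks where ks: "as = map ?f ks" "set ks \<subseteq> {1..m}" by blast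
  \<comment> \<open>The index sum m + 1 is the least one that leaves [m]_a; on {1..m} the truncated
    subtraction is exact, so the reflection is injective and maps {1..m} into itself.\<close>
  define ls where "ls = map (\<lambda>k. m + 1 - k) ks"
  define bs where "bs = map ?f ls"
  have ls: "set ls \<subseteq> {1..m}" using ks(2) by (fastforce simp: ls_def)
  have "inj_on (\<lambda>k. m + 1 - k) (set ks)" using ks(2) by (fastforce simp: inj_on_def)
  then have dls: "distinct ls" using d ks(1) by (simp add: ls_def distinct_map)
  have injm: "inj_on ?f {1..m}" using inj by (rule inj_on_subset) auto
  have dbs: "distinct bs" using dls inj_on_subset[OF injm ls] by (simp add: bs_def distinct_map)
  have cbs: "card (set bs) = n" using distinct_card[OF dbs] len ks(1) by (simp add: bs_def ls_def)
  have bsub: "set bs \<subseteq> multiples m a" using ls by (auto simp: bs_def multiples_def)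
  \<comment> \<open>Only ma can lie outside [m-1]_a, so intersecting loses at most one of the n
    elements.\<close>
  have "{1..m} \<subseteq> insert m {1..m - 1}" by auto
  then have "set bs - {?f m} \<subseteq> set bs \<inter> multiples (m - 1) a"
    using bsub unfolding multiples_def by blast
  then have "card (set bs - {?f m}) \<le> card (set bs \<inter> multiples (m - 1) a)"
    by (intro card_mono) auto
  then have "n - 1 \<le> card (set bs \<inter> multiples (m - 1) a)"
    using cbs diff_card_le_card_Diff[of "{?f m}" "set bs"] by simp
  then have "ordered_basis (panhandle n (m - 1) m a) bs"
    using dbs cbs bsub by (simp add: ordered_basis_def panhandle_def)
  moreover have "as ! i + bs ! i \<notin> ground M" if "i < length as" for i
  proof -
    have i: "i < length ks" using that ks(1) by simp
    have k: "ks ! i \<in> {1..m}" using nth_mem[OF i] ks(2) by blast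
    then have "m + 1 - ks ! i \<in> {1..m}" "\<not> ks ! i + (m + 1 - ks ! i) \<le> m" by auto
    then show ?thesis
      using nmult_add_mem_multiples_iff[OF inj k] i by (simp add: ks(1) bs_def ls_def ground)
  qed
  ultimately show "\<exists>bs. ordered_basis (panhandle n (m - 1) m a) bs \<and> matched_bases M as bs"
    using ks(1) by (auto simp: matched_bases_def bs_def ls_def)
qed

text \<open>An obstruction from the single basis [n]_a, so that one argument serves both panhandle
  and Schubert matroids.\<close>

lemma not_matched_to_panhandle:
  fixes a :: "'g::ab_group_add"
  assumes inj: "inj_on (\<lambda>i. nmult i a) {..4 * m}" and ground: "ground M = multiples m a"
    and basis: "multiples n a \<in> bases M" and n: "2 \<le> n" "n \<le> m" and t: "t < m - 1"
  shows "\<not> matched_to M (panhandle n t m a)"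
proof
  let ?f = "\<lambda>i. nmult i a"
  assume mt: "matched_to M (panhandle n t m a)"
  have injn: "inj_on ?f {1..n}" using inj by (rule inj_on_subset) (use n in auto)
  define as where "as = map ?f [1..<Suc n]"
  have "ordered_basis M as"
    using basis injn by (simp add: ordered_basis_def as_def distinct_map multiples_def
        atLeastLessThanSuc_atLeastAtMost del: upt_Suc)
  then obtain bs where bs: "ordered_basis (panhandle n t m a) bs" "matched_bases M as bs"
    using mt by (auto simp: matched_to_def)
  have d: "distinct bs" and sub: "set bs \<subseteq> ?f ` {1..m}" and c: "n - 1 \<le> card (set bs \<inter> multiples t a)"
    using bs(1) by (auto simp: ordered_basis_def panhandle_def multiples_def)
  have len: "length bs = n" using bs(2) by (simp add: matched_bases_def as_def del: upt_Suc)
  \<comment> \<open>List positions start at 0, so \<open>as ! i\<close> is (i + 1)a with i + 1 at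
    most 2. A partner la with l \<le> t \<le> m - 2 would keep the index sum at most m, hence the
    sum in the ground set.\<close>
  have out: "bs ! i \<notin> multiples t a" if i: "i < 2" for i
  proof
    assume "bs ! i \<in> multiples t a"
    then obtain l where l: "l \<in> {1..t}" "bs ! i = ?f l" by (auto simp: multiples_def)
    have "as ! i = ?f (Suc i)" using i n by (simp add: as_def del: upt_Suc nmult_Suc)
    moreover have "as ! i + bs ! i \<notin> multiples m a"
      using bs(2) ground i n len by (simp add: matched_bases_def)
    moreover have "?f (Suc i) + ?f l \<in> multiples m a"
      using l t i n by (subst nmult_add_mem_multiples_iff[OF inj]) auto
    ultimately show False using l by simp
  qed
  have neq: "bs ! 0 \<noteq> bs ! 1" using d len n by (simp add: nth_eq_iff_index_eq)
  have two: "{bs ! 0, bs ! 1} \<subseteq> set bs" using len n by simp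
  have "set bs \<inter> multiples t a \<subseteq> set bs - {bs ! 0, bs ! 1}" using out[of 0] out[of 1] by auto
  then have "card (set bs \<inter> multiples t a) \<le> card (set bs - {bs ! 0, bs ! 1})"
    by (intro card_mono) auto
  also have "\<dots> = n - 2"
    using two neq len distinct_card[OF d] by (subst card_Diff_subset) auto
  \<comment> \<open>As 2 \<le> n, the truncated difference n - 2 is strictly below n - 1.\<close>
  finally show False using c n by linarith
qed

lemma multiples_mem_bases_panhandle:
  assumes "inj_on (\<lambda>i. nmult i a) {1..m}" "n \<le> s" "s \<le> m"
  shows "multiples n a \<in> bases (panhandle n s m a)"
proof -
  have "card (multiples n a) = n"
    using card_image[OF inj_on_subset[OF assms(1), of "{1..n}"]] assms by (simp add: multiples_def)
  moreover have "multiples n a \<subseteq> multiples m a" "multiples n a \<subseteq> multiples s a"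
    using assms by (auto simp: multiples_def)
  ultimately show ?thesis by (simp add: panhandle_def Int_absorb2)
qed

text \<open>The initial segment is the componentwise least n-subset. In the counting form of
  \<open>schubert_basis_iff\<close>: a set of positive indices L has at most min(|L|, z) elements up
  to z, and {1..|L|} attains this bound.\<close>

lemma multiples_mem_bases_schubert:
  fixes a :: "'g::ab_group_add"
  assumes inj: "inj_on (\<lambda>i. nmult i a) {..4 * m}" and ord: "compatible_order m a r"
    and S: "S \<subseteq> multiples m a"
  shows "multiples (card S) a \<in> bases (schubert r m a S)"
proof -
  let ?f = "\<lambda>i. nmult i a"
  obtain L where L: "L \<subseteq> {1..m}" "S = ?f ` L" using S unfolding multiples_def by (meson subset_imageE)
  have injm: "inj_on ?f {1..m}" using inj by (rule inj_on_subset) auto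
  have fin: "finite L" using L(1) finite_subset by blast
  have cL: "card S = card L" using card_image[OF inj_on_subset[OF injm L(1)]] L(2) by simp
  have cm: "card L \<le> m" using card_mono[OF _ L(1)] by simp
  have "card {j\<in>L. j \<le> z} \<le> card {j\<in>{1..card L}. j \<le> z}" for z
  proof -
    have "{j\<in>L. j \<le> z} \<subseteq> {1..z}" using L(1) by auto
    then have "card {j\<in>L. j \<le> z} \<le> z" using card_mono[of "{1..z}" "{j\<in>L. j \<le> z}"] by simp
    moreover have "card {j\<in>L. j \<le> z} \<le> card L" using fin by (intro card_mono) auto
    moreover have "{j\<in>{1..card L}. j \<le> z} = {1..min (card L) z}" by auto
    ultimately show ?thesis by simp
  qed
  then show ?thesis
    using schubert_basis_iff[OF inj ord _ L(1), of "{1..card L}"] cm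
    by (simp add: L(2)[symmetric] cL multiples_def)
qed

theorem theorem4p4:
  fixes a :: "'g::ab_group_add"
    and n s s' m :: nat
    and S :: "'g set"
    and r :: "'g rel"
    and M :: "'g basis_system"
  assumes "0 < n" and "n \<le> s" and "s < m" and "n \<le> s'" and "s' < m"
    and "\<forall>q. min_subgroup_card TYPE('g) = enat q \<longrightarrow> real m < real_of_int \<lceil>log 2 (real q)\<rceil> / 2"
    and "a \<noteq> 0"
    and "S \<subseteq> multiples m a" and "card S = n"
    and "compatible_order m a r"
    and "M = panhandle n s m a \<or> M = schubert r m a S"
  shows "(2 \<le> n \<longrightarrow> (matched_to M (panhandle n s' m a) \<longleftrightarrow> s' = m - 1)) \<and>
         (n = 1 \<longrightarrow> s' = m - 1 \<longrightarrow> matched_to M (panhandle n s' m a))"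
proof -
  have inj: "inj_on (\<lambda>i. nmult i a) {..4 * m}" using inj_on_nmult assms(6,7) by blast
  then have injm: "inj_on (\<lambda>i. nmult i a) {1..m}" by (rule inj_on_subset) auto
  have ground: "ground M = multiples m a"
    using assms(11) by (auto simp: panhandle_def schubert_def)
  have bases: "B \<subseteq> multiples m a \<and> card B = n" if "B \<in> bases M" for B
    using that assms(9,11) by (auto simp: panhandle_def schubert_def)
  have "multiples n a \<in> bases M"
    using assms(11) multiples_mem_bases_panhandle[OF injm \<open>n \<le> s\<close>] \<open>s < m\<close>
      multiples_mem_bases_schubert[OF inj assms(10,8)] \<open>card S = n\<close> by auto
  \<comment> \<open>For n = 1 this direction fails: every singleton is then a basis of the panhandle
    matroid for any s', so a matching exists even when s' < m - 1.\<close>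
  then have "s' = m - 1" if "2 \<le> n" "matched_to M (panhandle n s' m a)"
    using not_matched_to_panhandle[OF inj ground, of n s'] that assms(2,3,5) by linarith
  then show ?thesis using matched_to_panhandle_top[OF inj ground bases] by blast
qed

end
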